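(* Let $T=\{0,1/2,1/3,\ldots,1/n,\ldots\}$. Let $\{\lambda_j\}_{j\ge 2}$, $\{f_j\}_{j\ge 2}$, $\{g_j\}_{j\ge 2}$ be real sequences with $\lambda_j>0$, $0<f_j<1$, $0<g_j<1$ for all $j\ge 2$, $\lim_{n\to\infty}\lambda_n=0$, and $$\sum_{j=2}^{\infty}\frac{1-f_j}{\lambda_j}<1,\qquad \sum_{j=2}^{\infty}\frac{1-g_j}{\lambda_j}<1 .$$ Let $U$ be the kernel on $T$ defined by $U(0,0)=2$, $U(0,1/j)=1+g_j$, $U(1/i,0)=1+f_i$ and $U(1/i,1/j)=\lambda_i\delta_{i,j}+1+f_ig_j$ for $i,j\ge 2$. Then for every $\alpha>0$ there exists an $\alpha$-permanental sequence $X_{(\alpha)}=\{X_{(\alpha),s},\,s\in T\}$ with kernel $U$.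
   Context: An $\alpha$-permanental vector with kernel $K$ (an $n\times n$ matrix), $\alpha>0$, is a random vector $(X_1,\ldots,X_n)$ with values in $[0,\infty)^n$ such that for every diagonal matrix $S$ with non-negative diagonal entries $s_1,\ldots,s_n$, $$E\Big(e^{-\sum_{i=1}^n s_iX_i}\Big)=\frac{1}{|I+KS|^{\alpha}},$$ where $|\cdot|$ denotes the determinant. An $\alpha$-permanental process (sequence) on $T$ with kernel $\{K(s,t);s,t\in T\}$ is a stochastic process $\{X_t,t\in T\}$ such that for all distinct $t_1,\ldots,t_n\in T$, $(X_{t_1},\ldots,X_{t_n})$ is an $\alpha$-permanental vector with kernel $\{K(t_i,t_j)\}_{i,j=1}^n$. *)

theory Defs
  imports "HOL-Probability.Probability" "Jordan_Normal_Form.Determinant"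
begin

text \<open>The paper's vectors and matrices are indexed by \<open>1, ..., n\<close>, here by \<open>0, ..., n - 1\<close>;
  only \<open>X i\<close> with \<open>i < n\<close> are constrained.
  The determinant is raised to the power \<open>\<alpha>\<close> with \<open>powr\<close>, which has conventional values
  at bases that are not positive. The defining identity rules these out: its left-hand side
  is positive, so the determinant never vanishes (\<open>0 powr \<alpha> = 0\<close> and \<open>1 / 0 = 0\<close>),
  and it is continuous in \<open>s\<close> and equal to \<open>1\<close> at \<open>s = 0\<close>, hence positive for all
  \<open>s\<close> with nonnegative entries.\<close>

definition permanental_vector ::
  "'w measure \<Rightarrow> real \<Rightarrow> nat \<Rightarrow> real Matrix.mat \<Rightarrow> (nat \<Rightarrow> 'w \<Rightarrow> real) \<Rightarrow> bool" where
  "permanental_vector M \<alpha> n K X \<longleftrightarrow>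
     prob_space M \<and> \<alpha> > 0 \<and> K \<in> carrier_mat n n \<and>
     (\<forall>i<n. X i \<in> borel_measurable M) \<and>
     (\<forall>i<n. \<forall>w\<in>space M. X i w \<ge> 0) \<and>
     (\<forall>s :: nat \<Rightarrow> real. (\<forall>i<n. s i \<ge> 0) \<longrightarrow>
        (\<integral>w. exp (- (\<Sum>i<n. s i * X i w)) \<partial>M) =
          1 / Determinant.det (1\<^sub>m n + K * mat_diag n s) powr \<alpha>)"

definition permanental_process ::
  "'w measure \<Rightarrow> real \<Rightarrow> 't set \<Rightarrow> ('t \<Rightarrow> 't \<Rightarrow> real) \<Rightarrow> ('t \<Rightarrow> 'w \<Rightarrow> real) \<Rightarrow> bool" where
  "permanental_process M \<alpha> T K X \<longleftrightarrow>
     (\<forall>n. \<forall>t :: nat \<Rightarrow> 't. inj_on t {..<n} \<and> t ` {..<n} \<subseteq> T \<longrightarrow>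
        permanental_vector M \<alpha> n (Matrix.mat n n (\<lambda>(i, j). K (t i) (t j))) (\<lambda>i. X (t i)))"

end

theory Submission
  imports Defs
begin

text \<open>
  Write \<open>d i = s i / (1 + \<lambda> i * s i)\<close>, \<open>u = 1 - f\<close>, \<open>v = 1 - g\<close>, with \<open>\<lambda> = u = v = 0\<close> at the
  point \<open>0\<close>. As \<open>U\<close> is a diagonal matrix plus a matrix of rank two, \<open>det (I + U S)\<close> is the product
  of the \<open>1 + \<lambda> i * s i\<close> times \<open>(1 + \<Sum> d) Q - (1 + \<Sum> u d) (1 + \<Sum> v d)\<close>, where
  \<open>Q = 2 + \<Sum> u v d\<close>. The second factor equals \<open>Q R - X Y\<close>, where \<open>R\<close> is a positive constant
  plus a combination of the \<open>d i\<close>, where \<open>X\<close> and \<open>Y\<close> are combinations of the Laplace transforms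
  \<open>1 / (1 + \<lambda> i * s i)\<close>, and where the two conditions on the sums make all weights nonnegative.
  By the binomial series, the power \<open>- \<alpha>\<close> of \<open>Q R - X Y\<close> is a combination with nonnegative
  coefficients of the products \<open>X ^ k * Y ^ k * (Q R) powr - (\<alpha> + k)\<close>. Each factor is,
  up to normalization, the Laplace functional of a random sequence: \<open>X\<close> and \<open>Y\<close> of one
  exponential variable at a random site, negative powers of \<open>Q\<close> and \<open>R\<close> of independent compound
  Poisson variables with a common gamma distributed intensity. Laplace functionals are closed under
  products (independent sums) and mixtures.
\<close>

section \<open>Laplace functionals of random sequences\<close>

text \<open>Cylinder sets form an intersection-stable generator, and the mass of a cylinder is a
  finite product of measurable functions of \<open>x\<close>. This makes coordinates that are
  independent given a random parameter into a kernel.\<close>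

lemma measurable_PiM_kernel:
  assumes \<nu>: "\<And>i. \<nu> i \<in> M \<rightarrow>\<^sub>M prob_algebra (N i)"
  shows "(\<lambda>x. \<Pi>\<^sub>M i\<in>UNIV. \<nu> i x) \<in> M \<rightarrow>\<^sub>M prob_algebra (\<Pi>\<^sub>M i\<in>UNIV. N i)"
proof (rule measurable_prob_algebra_generated[OF sets_PiM Int_stable_prod_algebra prod_algebra_sets_into_space])
  have prob: "prob_space (\<nu> i x)" and sets: "sets (\<nu> i x) = sets (N i)" if "x \<in> space M" for i x
    using measurable_space[OF \<nu> that] by (auto simp: space_prob_algebra)
  fix x assume x: "x \<in> space M"
  show "prob_space (\<Pi>\<^sub>M i\<in>UNIV. \<nu> i x)"
    by (intro prob_space_PiM prob x)
  show "sets (\<Pi>\<^sub>M i\<in>UNIV. \<nu> i x) = sets (\<Pi>\<^sub>M i\<in>UNIV. N i)"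
    by (intro sets_PiM_cong refl sets x)
next
  have prob: "prob_space (\<nu> i x)" and sets: "sets (\<nu> i x) = sets (N i)" if "x \<in> space M" for i x
    using measurable_space[OF \<nu> that] by (auto simp: space_prob_algebra)
  note spaces = sets_eq_imp_space_eq[OF sets]
  fix A assume "A \<in> prod_algebra UNIV N"
  then obtain J E where A: "A = prod_emb UNIV N J (Pi\<^sub>E J E)" "finite J" "\<And>i. i \<in> J \<Longrightarrow> E i \<in> sets (N i)"
    by (rule prod_algebraE) auto
  have "emeasure (\<Pi>\<^sub>M i\<in>UNIV. \<nu> i x) A = (\<Prod>i\<in>J. emeasure (\<nu> i x) (E i))" if x: "x \<in> space M" for x
  proof -
    have "A = prod_emb UNIV (\<lambda>i. \<nu> i x) J (Pi\<^sub>E J E)"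
      by (simp add: A(1) prod_emb_def spaces x)
    then show ?thesis
      using A x by (simp add: emeasure_PiM_emb prob sets)
  qed
  moreover have "(\<lambda>x. \<Prod>i\<in>J. emeasure (\<nu> i x) (E i)) \<in> borel_measurable M"
  proof (intro borel_measurable_prod_ennreal)
    fix i assume "i \<in> J"
    then show "(\<lambda>x. emeasure (\<nu> i x) (E i)) \<in> borel_measurable M"
      using measurable_prob_algebraD[OF \<nu>[of i]] A(3) by measurable
  qed
  ultimately show "(\<lambda>x. emeasure (\<Pi>\<^sub>M i\<in>UNIV. \<nu> i x) A) \<in> borel_measurable M"
    by (simp cong: measurable_cong)
qed

abbreviation seq_space :: "(nat \<Rightarrow> real) measure" where
  "seq_space \<equiv> \<Pi>\<^sub>M i\<in>UNIV. borel"

text \<open>The absolute values make every measure on sequences eligible, so that no support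
  condition has to be carried along.\<close>

definition laplace :: "(nat \<Rightarrow> real) measure \<Rightarrow> nat set \<Rightarrow> (nat \<Rightarrow> real) \<Rightarrow> ennreal" where
  "laplace \<mu> J s = (\<integral>\<^sup>+x. ennreal (exp (- (\<Sum>i\<in>J. s i * \<bar>x i\<bar>))) \<partial>\<mu>)"

text \<open>One measure serves all finite index sets \<open>J\<close> at once, so no extension theorem
  is needed to pass from finite-dimensional laws to a process.\<close>

definition realizable :: "(nat set \<Rightarrow> (nat \<Rightarrow> real) \<Rightarrow> real) \<Rightarrow> bool" where
  "realizable \<phi> \<longleftrightarrow> (\<exists>\<mu>\<in>space (prob_algebra seq_space).
     \<forall>J s. finite J \<longrightarrow> (\<forall>i\<in>J. 0 \<le> s i) \<longrightarrow> laplace \<mu> J s = ennreal (\<phi> J s))"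

lemma measurable_laplace_integrand [measurable]:
  "(\<lambda>x. ennreal (exp (- (\<Sum>i\<in>J. s i * \<bar>x i\<bar>)))) \<in> borel_measurable seq_space"
  by measurable

section \<open>Closure under mixtures, series and products\<close>

lemma realizable_cong:
  assumes "realizable \<phi>" "\<And>J s. finite J \<Longrightarrow> (\<And>i. i \<in> J \<Longrightarrow> 0 \<le> s i) \<Longrightarrow> \<phi> J s = \<psi> J s"
  shows "realizable \<psi>"
  using assms unfolding realizable_def by auto

lemma realizable_mixture:
  assumes P: "prob_space P" and K: "K \<in> P \<rightarrow>\<^sub>M prob_algebra seq_space"
    and lap: "\<And>J s. finite J \<Longrightarrow> (\<And>i. i \<in> J \<Longrightarrow> 0 \<le> s i) \<Longrightarrow>
      (\<integral>\<^sup>+\<omega>. laplace (K \<omega>) J s \<partial>P) = ennreal (\<phi> J s)"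
  shows "realizable \<phi>"
  unfolding realizable_def
proof (intro bexI allI impI)
  \<comment> \<open>A constant kernel on a one-point space turns measurability of the bind into
    membership in \<open>prob_algebra\<close>.\<close>
  have "(\<lambda>_. P) \<in> count_space {()} \<rightarrow>\<^sub>M prob_algebra P"
    using P by (auto simp: space_prob_algebra)
  from measurable_space[OF measurable_bind_prob_space[OF this K], of "()"]
  show "P \<bind> K \<in> space (prob_algebra seq_space)" by simp
  fix J and s :: "nat \<Rightarrow> real" assume "finite J" "\<forall>i\<in>J. 0 \<le> s i"
  then show "laplace (P \<bind> K) J s = ennreal (\<phi> J s)"
    using lap[of J s] measurable_prob_algebraD[OF K]
    by (simp add: laplace_def nn_integral_bind[where B=seq_space])
qed

text \<open>A mixture over a random index \<open>k\<close> drawn with probability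
  \<open>c k\<close>.\<close>

lemma realizable_suminf:
  fixes c :: "nat \<Rightarrow> real"
  assumes c: "\<And>k. 0 \<le> c k" "c sums 1"
    and \<phi>: "\<And>k. realizable (\<phi> k)"
    and \<phi>0: "\<And>k J s. finite J \<Longrightarrow> (\<And>i. i \<in> J \<Longrightarrow> 0 \<le> s i) \<Longrightarrow> 0 \<le> \<phi> k J s"
    and sums: "\<And>J s. finite J \<Longrightarrow> (\<And>i. i \<in> J \<Longrightarrow> 0 \<le> s i) \<Longrightarrow> (\<lambda>k. c k * \<phi> k J s) sums \<psi> J s"
  shows "realizable \<psi>"
proof -
  obtain \<mu> where \<mu>: "\<And>k. \<mu> k \<in> space (prob_algebra seq_space)"
    "\<And>k J s. finite J \<Longrightarrow> (\<And>i. i \<in> J \<Longrightarrow> 0 \<le> s i) \<Longrightarrow> laplace (\<mu> k) J s = ennreal (\<phi> k J s)"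
    using \<phi> unfolding realizable_def by metis
  define P where "P = density (count_space UNIV) (\<lambda>k. ennreal (c k))"
  show ?thesis
  proof (rule realizable_mixture)
    show "prob_space P"
    proof
      show "emeasure P (space P) = 1"
        using c by (simp add: P_def emeasure_density nn_integral_count_space_nat suminf_ennreal_eq
          sums_unique[symmetric])
    qed
    show "\<mu> \<in> P \<rightarrow>\<^sub>M prob_algebra seq_space"
      using \<mu>(1) by (simp add: P_def)
    fix J and s :: "nat \<Rightarrow> real" assume Js: "finite J" "\<And>i. i \<in> J \<Longrightarrow> 0 \<le> s i"
    have "(\<integral>\<^sup>+k. laplace (\<mu> k) J s \<partial>P) = (\<Sum>k. ennreal (c k) * ennreal (\<phi> k J s))"
      using \<mu>(2)[OF Js] by (simp add: P_def nn_integral_density nn_integral_count_space_nat)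
    also have "\<dots> = ennreal (\<psi> J s)"
      using sums[OF Js] c(1) \<phi>0[OF Js] by (simp add: ennreal_mult[symmetric] suminf_ennreal_eq)
    finally show "(\<integral>\<^sup>+k. laplace (\<mu> k) J s \<partial>P) = ennreal (\<psi> J s)" .
  qed
qed

lemma realizable_one: "realizable (\<lambda>J s. 1)"
  unfolding realizable_def
proof (intro bexI allI impI)
  show "return seq_space (\<lambda>_. 0) \<in> space (prob_algebra seq_space)"
    by (auto simp: space_prob_algebra space_PiM intro!: prob_space_return)
  show "laplace (return seq_space (\<lambda>_. 0)) J s = ennreal 1" for J s
    unfolding laplace_def by (subst nn_integral_return) (auto simp: space_PiM)
qed

lemma realizable_mult:
  assumes "realizable \<phi>" "realizable \<psi>"
    and nonneg: "\<And>J s. finite J \<Longrightarrow> (\<And>i. i \<in> J \<Longrightarrow> 0 \<le> s i) \<Longrightarrow> 0 \<le> \<phi> J s"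
  shows "realizable (\<lambda>J s. \<phi> J s * \<psi> J s)"
proof -
  obtain \<mu> where \<mu>: "\<mu> \<in> space (prob_algebra seq_space)"
    "\<And>J s. finite J \<Longrightarrow> (\<And>i. i \<in> J \<Longrightarrow> 0 \<le> s i) \<Longrightarrow> laplace \<mu> J s = ennreal (\<phi> J s)"
    using assms(1) unfolding realizable_def by auto
  obtain \<nu> where \<nu>: "\<nu> \<in> space (prob_algebra seq_space)"
    "\<And>J s. finite J \<Longrightarrow> (\<And>i. i \<in> J \<Longrightarrow> 0 \<le> s i) \<Longrightarrow> laplace \<nu> J s = ennreal (\<psi> J s)"
    using assms(2) unfolding realizable_def by auto
  have [measurable_cong]: "sets \<mu> = sets seq_space" "sets \<nu> = sets seq_space"
    using \<mu>(1) \<nu>(1) by (auto simp: space_prob_algebra)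
  interpret \<mu>: prob_space \<mu> using \<mu>(1) by (simp add: space_prob_algebra)
  interpret \<nu>: prob_space \<nu> using \<nu>(1) by (simp add: space_prob_algebra)
  interpret pair_prob_space \<mu> \<nu> ..
  \<comment> \<open>The sum of two independent sequences. Absolute values are taken before adding,
    so that the exponent splits exactly.\<close>
  define \<kappa> where "\<kappa> = distr (\<mu> \<Otimes>\<^sub>M \<nu>) seq_space (\<lambda>(x, y) i. \<bar>x i\<bar> + \<bar>y i\<bar>)"
  have meas [measurable]: "(\<lambda>(x, y) i. \<bar>x i\<bar> + \<bar>y i\<bar>) \<in> \<mu> \<Otimes>\<^sub>M \<nu> \<rightarrow>\<^sub>M seq_space"
    by (rule measurable_PiM_single') (auto simp: case_prod_beta space_PiM)
  show ?thesis
    unfolding realizable_def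
  proof (intro bexI allI impI)
    show "\<kappa> \<in> space (prob_algebra seq_space)"
      unfolding \<kappa>_def space_prob_algebra using prob_space_distr[OF meas] by simp
    fix J and s :: "nat \<Rightarrow> real" assume "finite J" and "\<forall>i\<in>J. 0 \<le> s i"
    then have Js: "finite J" "\<And>i. i \<in> J \<Longrightarrow> 0 \<le> s i" by auto
    let ?e = "\<lambda>x. ennreal (exp (- (\<Sum>i\<in>J. s i * \<bar>x i\<bar>)))"
    have [measurable]: "?e \<in> borel_measurable \<mu>" "?e \<in> borel_measurable \<nu>" by measurable
    have "laplace \<kappa> J s = (\<integral>\<^sup>+z. ?e (\<lambda>i. \<bar>fst z i\<bar> + \<bar>snd z i\<bar>) \<partial>(\<mu> \<Otimes>\<^sub>M \<nu>))"
      unfolding laplace_def \<kappa>_def by (subst nn_integral_distr) (auto simp: case_prod_beta)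
    also have "\<dots> = (\<integral>\<^sup>+z. ?e (fst z) * ?e (snd z) \<partial>(\<mu> \<Otimes>\<^sub>M \<nu>))"
      by (intro nn_integral_cong)
        (simp add: abs_of_nonneg ring_distribs sum.distrib exp_add[symmetric] ennreal_mult[symmetric])
    also have "\<dots> = (\<integral>\<^sup>+x. \<integral>\<^sup>+y. ?e x * ?e y \<partial>\<nu> \<partial>\<mu>)"
      by (subst \<nu>.nn_integral_fst[symmetric]) auto
    also have "\<dots> = laplace \<mu> J s * laplace \<nu> J s"
      by (simp add: nn_integral_cmult nn_integral_multc laplace_def)
    finally show "laplace \<kappa> J s = ennreal (\<phi> J s * \<psi> J s)"
      using \<mu>(2)[OF Js] \<nu>(2)[OF Js] nonneg[OF Js] by (simp add: ennreal_mult')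
  qed
qed

lemma realizable_power:
  assumes "realizable \<phi>" "\<And>J s. finite J \<Longrightarrow> (\<And>i. i \<in> J \<Longrightarrow> 0 \<le> s i) \<Longrightarrow> 0 \<le> \<phi> J s"
  shows "realizable (\<lambda>J s. \<phi> J s ^ k)"
  by (induction k) (simp_all add: realizable_one realizable_mult assms)

section \<open>Independent coordinates and gamma laws\<close>

lemma laplace_PiM:
  assumes \<nu>: "\<And>i. \<nu> i \<in> space (prob_algebra borel)" and J: "finite J"
  shows "laplace (\<Pi>\<^sub>M i\<in>UNIV. \<nu> i) J s = (\<Prod>i\<in>J. \<integral>\<^sup>+y. ennreal (exp (- (s i * \<bar>y\<bar>))) \<partial>\<nu> i)"
proof -
  have prob: "prob_space (\<nu> i)" and sets[measurable_cong]: "sets (\<nu> i) = sets borel" for i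
    using \<nu> by (auto simp: space_prob_algebra)
  interpret product_prob_space \<nu> UNIV
    by (intro product_prob_spaceI prob)
  let ?e = "\<lambda>i y. ennreal (exp (- (s i * \<bar>y\<bar>)))"
  have e: "?e i \<in> borel_measurable (\<nu> i)" for i by measurable
  have "laplace (\<Pi>\<^sub>M i\<in>UNIV. \<nu> i) J s = (\<integral>\<^sup>+x. (\<Prod>i\<in>J. ?e i (x i)) \<partial>(\<Pi>\<^sub>M i\<in>UNIV. \<nu> i))"
    unfolding laplace_def
    by (intro nn_integral_cong) (simp add: exp_sum[OF J] sum_negf[symmetric] prod_ennreal)
  \<comment> \<open>The integrand depends only on the coordinates in \<open>J\<close>, so the
    integral passes to a finite product.\<close>
  also have "\<dots> = (\<integral>\<^sup>+x. (\<Prod>i\<in>J. ?e i (x i)) \<partial>distr (\<Pi>\<^sub>M i\<in>UNIV. \<nu> i) (Pi\<^sub>M J \<nu>) (\<lambda>x. restrict x J))"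
    by (subst nn_integral_distr) (auto intro!: borel_measurable_prod_ennreal measurable_restrict_subset)
  also have "\<dots> = (\<integral>\<^sup>+x. (\<Prod>i\<in>J. ?e i (x i)) \<partial>Pi\<^sub>M J \<nu>)"
    by (subst distr_PiM_restrict_finite) (use J in auto)
  also have "\<dots> = (\<Prod>i\<in>J. \<integral>\<^sup>+y. ?e i y \<partial>\<nu> i)"
    by (rule product_nn_integral_prod[OF J e])
  finally show ?thesis .
qed

definition gamma_measure :: "real \<Rightarrow> real measure" where
  "gamma_measure \<beta> = density lborel (\<lambda>t. ennreal (indicator {0..} t * t powr (\<beta> - 1) / exp t / Gamma \<beta>))"

lemma sets_gamma_measure [measurable_cong, simp]: "sets (gamma_measure \<beta>) = sets borel"
  by (simp add: gamma_measure_def)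

text \<open>The substitution \<open>t = (1 + r) * x\<close> in Euler's integral merges the
  exponential with the density. The case \<open>r = 0\<close> gives total mass 1.\<close>

lemma nn_integral_gamma_measure:
  assumes "\<beta> > 0" "r \<ge> 0"
  shows "(\<integral>\<^sup>+x. ennreal (exp (- (r * \<bar>x\<bar>))) \<partial>gamma_measure \<beta>) = ennreal ((1 + r) powr - \<beta>)"
proof -
  let ?f = "\<lambda>t::real. indicator {0..} t * t powr (\<beta> - 1) / exp t"
  have G: "Gamma \<beta> > 0" using assms by (simp add: Gamma_real_pos)
  have r: "1 + r > 0" using assms by simp
  have "ennreal (Gamma \<beta>) = ennreal (1 + r) * (\<integral>\<^sup>+x. ennreal (?f ((1 + r) * x)) \<partial>lborel)"
    using Gamma_conv_nn_integral_real[OF assms(1)] nn_integral_real_affine[of "\<lambda>t. ennreal (?f t)" "1 + r" 0] r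
    by simp
  then have "ennreal ((1 + r) powr - \<beta>) =
      ennreal ((1 + r) powr - \<beta> / Gamma \<beta>) * (ennreal (1 + r) * (\<integral>\<^sup>+x. ennreal (?f ((1 + r) * x)) \<partial>lborel))"
    using G by (metis divide_nonneg_nonneg ennreal_mult less_eq_real_def nonzero_eq_divide_eq
        order_less_irrefl powr_ge_zero)
  also have "\<dots> = (\<integral>\<^sup>+x. ennreal ((1 + r) powr - \<beta> / Gamma \<beta>) * (ennreal (1 + r) * ennreal (?f ((1 + r) * x))) \<partial>lborel)"
    by (simp add: nn_integral_cmult)
  also have "\<dots> = (\<integral>\<^sup>+x. ennreal (indicator {0..} x * x powr (\<beta> - 1) / exp x / Gamma \<beta>) * ennreal (exp (- (r * \<bar>x\<bar>))) \<partial>lborel)"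
  proof (intro nn_integral_cong)
    fix x :: real
    have "(1 + r) powr - \<beta> / Gamma \<beta> * ((1 + r) * ?f ((1 + r) * x)) =
        indicator {0..} x * x powr (\<beta> - 1) / exp x / Gamma \<beta> * exp (- (r * \<bar>x\<bar>))"
    proof (cases "x \<ge> 0")
      case True
      have *: "(1 + r) powr - \<beta> * (1 + r) * (1 + r) powr (\<beta> - 1) = 1"
        using r by (simp add: powr_minus powr_diff)
      have "(1 + r) powr - \<beta> / Gamma \<beta> * ((1 + r) * ?f ((1 + r) * x)) =
          ((1 + r) powr - \<beta> * (1 + r) * (1 + r) powr (\<beta> - 1)) * (x powr (\<beta> - 1) / exp ((1 + r) * x) / Gamma \<beta>)"
        using True r by (simp add: powr_mult mult_ac)
      also have "\<dots> = x powr (\<beta> - 1) / exp x / Gamma \<beta> * exp (- (r * x))"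
        unfolding * by (simp add: ring_distribs exp_add exp_minus divide_simps)
      finally show ?thesis using True by simp
    next
      case False
      then have "(1 + r) * x < 0" using r by (simp add: mult_pos_neg)
      then show ?thesis using False by simp
    qed
    then show "ennreal ((1 + r) powr - \<beta> / Gamma \<beta>) * (ennreal (1 + r) * ennreal (?f ((1 + r) * x))) =
        ennreal (indicator {0..} x * x powr (\<beta> - 1) / exp x / Gamma \<beta>) * ennreal (exp (- (r * \<bar>x\<bar>)))"
      using r G by (simp add: ennreal_mult[symmetric])
  qed
  also have "\<dots> = (\<integral>\<^sup>+x. ennreal (exp (- (r * \<bar>x\<bar>))) \<partial>gamma_measure \<beta>)"
    unfolding gamma_measure_def by (subst nn_integral_density) auto
  finally show ?thesis by simp
qed

lemma prob_space_gamma_measure: "\<beta> > 0 \<Longrightarrow> prob_space (gamma_measure \<beta>)"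
  using nn_integral_gamma_measure[of \<beta> 0] by (intro prob_spaceI) simp

text \<open>Shape 0 is the point mass at 0, so that the transform
  \<open>(1 + l * s) powr - \<beta>\<close> holds there too. A compound sum without jumps and a
  coordinate that is to vanish use this case.\<close>

definition scaled_gamma :: "real \<Rightarrow> real \<Rightarrow> real measure" where
  "scaled_gamma \<beta> l =
    (if \<beta> = 0 then return borel 0 else distr (gamma_measure \<beta>) borel (\<lambda>x. l * x))"

lemma scaled_gamma_in_prob_algebra:
  "0 \<le> \<beta> \<Longrightarrow> scaled_gamma \<beta> l \<in> space (prob_algebra borel)"
  by (auto simp: scaled_gamma_def space_prob_algebra
      intro!: prob_space_return prob_space.prob_space_distr prob_space_gamma_measure)

lemma nn_integral_scaled_gamma:
  assumes "0 \<le> \<beta>" "0 \<le> l" "0 \<le> s"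
  shows "(\<integral>\<^sup>+y. ennreal (exp (- (s * \<bar>y\<bar>))) \<partial>scaled_gamma \<beta> l) = ennreal ((1 + l * s) powr - \<beta>)"
proof (cases "\<beta> = 0")
  case True
  then show ?thesis
    using assms add_pos_nonneg[of 1 "l * s"]
    by (simp add: scaled_gamma_def nn_integral_return)
next
  case False
  then show ?thesis
    using nn_integral_gamma_measure[of \<beta> "l * s"] assms
    by (simp add: scaled_gamma_def nn_integral_distr abs_mult mult_ac)
qed

lemma realizable_prod_powr:
  assumes "\<And>i. 0 \<le> \<beta> i" "\<And>i. 0 \<le> l i"
  shows "realizable (\<lambda>J s. \<Prod>i\<in>J. (1 + l i * s i) powr - \<beta> i)"
  unfolding realizable_def
proof (intro bexI allI impI)
  let ?\<nu> = "\<lambda>i. scaled_gamma (\<beta> i) (l i)"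
  have \<nu>: "?\<nu> i \<in> space (prob_algebra borel)" for i
    by (rule scaled_gamma_in_prob_algebra[OF assms(1)])
  have "(\<lambda>_::unit. \<Pi>\<^sub>M i\<in>UNIV. ?\<nu> i) \<in> count_space UNIV \<rightarrow>\<^sub>M prob_algebra seq_space"
    using \<nu> by (intro measurable_PiM_kernel) simp
  from measurable_space[OF this, of "()"]
  show "(\<Pi>\<^sub>M i\<in>UNIV. ?\<nu> i) \<in> space (prob_algebra seq_space)" by simp
  fix J and s :: "nat \<Rightarrow> real" assume "finite J" "\<forall>i\<in>J. 0 \<le> s i"
  then show "laplace (\<Pi>\<^sub>M i\<in>UNIV. ?\<nu> i) J s = ennreal (\<Prod>i\<in>J. (1 + l i * s i) powr - \<beta> i)"
    by (simp add: laplace_PiM[OF \<nu>] nn_integral_scaled_gamma assms prod_ennreal)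
qed

section \<open>Compound Poisson laws with gamma distributed intensity\<close>

definition poisson_measure :: "real \<Rightarrow> nat measure" where
  "poisson_measure \<rho> = density (count_space UNIV) (\<lambda>n. ennreal (\<rho> ^ n / fact n * exp (- \<rho>)))"

lemma nn_integral_poisson_measure:
  "(\<integral>\<^sup>+n. f n \<partial>poisson_measure \<rho>) = (\<Sum>n. ennreal (\<rho> ^ n / fact n * exp (- \<rho>)) * f n)"
  by (simp add: poisson_measure_def nn_integral_density nn_integral_count_space_nat)

text \<open>The generating function of the Poisson law, from the exponential series at
  \<open>\<rho> * z\<close>. The case \<open>z = 1\<close> gives total mass 1.\<close>

lemma suminf_poisson:
  assumes "\<rho> \<ge> 0" "z \<ge> 0"
  shows "(\<Sum>n. ennreal (\<rho> ^ n / fact n * exp (- \<rho>)) * ennreal (z ^ n)) = ennreal (exp (- (\<rho> * (1 - z))))"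
proof -
  have "(\<lambda>n. ((\<rho> * z) ^ n /\<^sub>R fact n) * exp (- \<rho>)) sums (exp (\<rho> * z) * exp (- \<rho>))"
    by (intro sums_mult2 exp_converges)
  then have "(\<lambda>n. \<rho> ^ n / fact n * exp (- \<rho>) * z ^ n) sums (exp (- (\<rho> * (1 - z))))"
    by (simp add: exp_add[symmetric] algebra_simps power_mult_distrib divide_inverse)
  then show ?thesis
    using assms by (simp add: ennreal_mult[symmetric] suminf_ennreal_eq sums_unique[symmetric])
qed

lemma measurable_poisson_measure:
  assumes [measurable]: "r \<in> borel_measurable M" and nonneg: "\<And>x. 0 \<le> r x"
  shows "(\<lambda>x. poisson_measure (r x)) \<in> M \<rightarrow>\<^sub>M prob_algebra (count_space UNIV)"
proof (rule measurable_prob_algebra_generated[of _ UNIV UNIV])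
  show "sets (count_space UNIV) = sigma_sets UNIV (UNIV :: nat set set)"
    by (auto intro: sigma_sets.Basic)
  show "Int_stable (UNIV :: nat set set)" by (simp add: Int_stable_def)
  show "prob_space (poisson_measure (r x))" for x
    using suminf_poisson[OF nonneg[of x], of 1] nn_integral_poisson_measure[of "r x" "\<lambda>_. 1"]
    by (intro prob_spaceI) simp
  show "sets (poisson_measure (r x)) = sets (count_space UNIV)" for x
    by (simp add: poisson_measure_def)
  fix A :: "nat set"
  have "emeasure (poisson_measure (r x)) A = (\<Sum>n. ennreal (r x ^ n / fact n * exp (- r x)) * indicator A n)" for x
    by (subst nn_integral_poisson_measure[symmetric]) (simp add: poisson_measure_def)
  then show "(\<lambda>x. emeasure (poisson_measure (r x)) A) \<in> borel_measurable M"
    by simp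
qed auto

text \<open>The parameter \<open>l = 0\<close> is the limit of small jumps at high rate, a deterministic drift;
  it is what the point \<open>0\<close> of the index set needs.\<close>

definition compound_poisson :: "real \<Rightarrow> real \<Rightarrow> real \<Rightarrow> real measure" where
  "compound_poisson c l \<xi> = (if l = 0 then return borel (c * \<xi>)
    else poisson_measure (\<bar>\<xi>\<bar> * c / l) \<bind> (\<lambda>n. scaled_gamma (real n) l))"

lemma scaled_gamma_kernel:
  "(\<lambda>n. scaled_gamma (real n) l) \<in> count_space UNIV \<rightarrow>\<^sub>M prob_algebra borel"
  by (simp add: scaled_gamma_in_prob_algebra)

lemma measurable_compound_poisson:
  assumes "0 \<le> c" "0 \<le> l"
  shows "compound_poisson c l \<in> borel \<rightarrow>\<^sub>M prob_algebra borel"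
proof (cases "l = 0")
  case True
  have "(\<lambda>\<xi>. return borel (c * \<xi>)) \<in> borel \<rightarrow>\<^sub>M prob_algebra borel"
    by measurable
  then show ?thesis by (simp add: compound_poisson_def[abs_def] True)
next
  case False
  have "(\<lambda>\<xi>. poisson_measure (\<bar>\<xi>\<bar> * c / l)) \<in> borel \<rightarrow>\<^sub>M prob_algebra (count_space UNIV)"
    using assms by (intro measurable_poisson_measure) auto
  from measurable_bind_prob_space[OF this scaled_gamma_kernel]
  show ?thesis by (simp add: compound_poisson_def[abs_def] False)
qed

text \<open>A sum of \<open>n\<close> exponential jumps of mean \<open>l\<close> has transform
  \<open>z ^ n\<close> with \<open>z = 1 / (1 + l * s)\<close>, and a Poisson number of them turns
  this into \<open>exp (- rate * (1 - z))\<close>. The rate contains \<open>1 / l\<close> to cancel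
  the \<open>l\<close> in \<open>1 - z = l * s / (1 + l * s)\<close>.\<close>

lemma nn_integral_compound_poisson:
  assumes "0 \<le> c" "0 \<le> l" "0 \<le> s"
  shows "(\<integral>\<^sup>+y. ennreal (exp (- (s * \<bar>y\<bar>))) \<partial>compound_poisson c l \<xi>) =
    ennreal (exp (- (\<bar>\<xi>\<bar> * (c * s / (1 + l * s)))))"
proof (cases "l = 0")
  case True
  then show ?thesis
    using assms by (simp add: compound_poisson_def nn_integral_return abs_mult mult_ac)
next
  case False
  then have l: "l > 0" using assms by simp
  let ?P = "poisson_measure (\<bar>\<xi>\<bar> * c / l)"
  have ls: "1 + l * s > 0" using l assms by (simp add: add_pos_nonneg)
  have z: "(1 + l * s) powr - real n = (1 / (1 + l * s)) ^ n" for n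
    using ls by (simp add: powr_minus powr_realpow divide_inverse power_inverse)
  have "(\<integral>\<^sup>+y. ennreal (exp (- (s * \<bar>y\<bar>))) \<partial>compound_poisson c l \<xi>) =
      (\<integral>\<^sup>+n. \<integral>\<^sup>+y. ennreal (exp (- (s * \<bar>y\<bar>))) \<partial>scaled_gamma (real n) l \<partial>?P)"
    unfolding compound_poisson_def using l measurable_prob_algebraD[OF scaled_gamma_kernel]
    by (auto simp: poisson_measure_def intro!: nn_integral_bind[where B=borel])
  also have "\<dots> = ennreal (exp (- (\<bar>\<xi>\<bar> * c / l * (1 - 1 / (1 + l * s)))))"
    using assms ls by (simp only: nn_integral_scaled_gamma of_nat_0_le_iff nn_integral_poisson_measure z)
      (intro suminf_poisson, auto)
  also have "\<bar>\<xi>\<bar> * c / l * (1 - 1 / (1 + l * s)) = \<bar>\<xi>\<bar> * (c * s / (1 + l * s))"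
    using l ls by (simp add: divide_simps)
  finally show ?thesis .
qed

text \<open>Given the intensity \<open>\<xi>\<close> the coordinates are independent, and their
  transforms multiply to the exponential of \<open>- \<bar>\<xi>\<bar>\<close> times the sum.
  Averaging over a gamma law of shape \<open>\<beta>\<close> yields the power.\<close>

lemma realizable_sum_powr:
  assumes \<beta>: "\<beta> > 0" and nonneg: "\<And>i. 0 \<le> c i" "\<And>i. 0 \<le> l i"
  shows "realizable (\<lambda>J s. (1 + (\<Sum>i\<in>J. c i * s i / (1 + l i * s i))) powr - \<beta>)"
proof (rule realizable_mixture)
  let ?K = "\<lambda>\<xi>. \<Pi>\<^sub>M i\<in>UNIV. compound_poisson (c i) (l i) \<xi>"
  note \<nu> = measurable_compound_poisson[OF nonneg]
  show "prob_space (gamma_measure \<beta>)" using \<beta> by (rule prob_space_gamma_measure)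
  have "?K \<in> borel \<rightarrow>\<^sub>M prob_algebra seq_space"
    by (intro measurable_PiM_kernel \<nu>)
  then show "?K \<in> gamma_measure \<beta> \<rightarrow>\<^sub>M prob_algebra seq_space"
    by (simp cong: measurable_cong_sets)
  fix J and s :: "nat \<Rightarrow> real" assume J: "finite J" and s: "\<And>i. i \<in> J \<Longrightarrow> 0 \<le> s i"
  let ?d = "\<lambda>i. c i * s i / (1 + l i * s i)"
  have "laplace (?K \<xi>) J s = ennreal (exp (- ((\<Sum>i\<in>J. ?d i) * \<bar>\<xi>\<bar>)))" for \<xi>
  proof -
    have "compound_poisson (c i) (l i) \<xi> \<in> space (prob_algebra borel)" for i
      using measurable_space[OF \<nu>] by simp
    then have "laplace (?K \<xi>) J s = (\<Prod>i\<in>J. ennreal (exp (- (\<bar>\<xi>\<bar> * ?d i))))"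
      using J s by (simp add: laplace_PiM nn_integral_compound_poisson nonneg)
    also have "\<dots> = ennreal (exp (\<Sum>i\<in>J. - (\<bar>\<xi>\<bar> * ?d i)))"
      by (simp add: prod_ennreal exp_sum J)
    finally show ?thesis by (simp add: sum_negf sum_distrib_left mult.commute)
  qed
  moreover have "0 \<le> (\<Sum>i\<in>J. ?d i)"
    using nonneg s by (intro sum_nonneg divide_nonneg_nonneg mult_nonneg_nonneg add_nonneg_nonneg) auto
  ultimately show "(\<integral>\<^sup>+\<xi>. laplace (?K \<xi>) J s \<partial>gamma_measure \<beta>) =
      ennreal ((1 + (\<Sum>i\<in>J. ?d i)) powr - \<beta>)"
    using nn_integral_gamma_measure[OF \<beta>] by simp
qed

section \<open>Determinants\<close>

text \<open>Sylvester's identity: factor the block matrix with rows \<open>(1, - A)\<close> and \<open>(B, 1)\<close>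
  into triangular blocks in two ways.\<close>

lemma det_one_plus_mult_commute:
  fixes A B :: "'a :: idom Matrix.mat"
  assumes A: "A \<in> carrier_mat n m" and B: "B \<in> carrier_mat m n"
  shows "Determinant.det (1\<^sub>m n + A * B) = Determinant.det (1\<^sub>m m + B * A)"
proof -
  let ?M = "four_block_mat (1\<^sub>m n) (- A) B (1\<^sub>m m)"
  have AB: "A * B \<in> carrier_mat n n" and BA: "B * A \<in> carrier_mat m m"
    using A B by auto
  let ?L = "four_block_mat (1\<^sub>m n) (0\<^sub>m n m) B (1\<^sub>m m)"
  have "?L * four_block_mat (1\<^sub>m n) (- A) (0\<^sub>m m n) (1\<^sub>m m + B * A) =
      four_block_mat (1\<^sub>m n * 1\<^sub>m n + 0\<^sub>m n m * 0\<^sub>m m n) (1\<^sub>m n * (- A) + 0\<^sub>m n m * (1\<^sub>m m + B * A))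
        (B * 1\<^sub>m n + 1\<^sub>m m * 0\<^sub>m m n) (B * (- A) + 1\<^sub>m m * (1\<^sub>m m + B * A))"
    using A B by (intro mult_four_block_mat) auto
  also have "B * (- A) + 1\<^sub>m m * (1\<^sub>m m + B * A) = 1\<^sub>m m"
    using A B BA by (intro eq_matI) auto
  also have "four_block_mat (1\<^sub>m n * 1\<^sub>m n + 0\<^sub>m n m * 0\<^sub>m m n) (1\<^sub>m n * (- A) + 0\<^sub>m n m * (1\<^sub>m m + B * A))
        (B * 1\<^sub>m n + 1\<^sub>m m * 0\<^sub>m m n) (1\<^sub>m m) = ?M"
    using A B BA by (intro arg_cong2[of _ _ _ _ "\<lambda>x y. four_block_mat x y _ _"] cong_four_block_mat) auto
  finally have 1: "?M = ?L * four_block_mat (1\<^sub>m n) (- A) (0\<^sub>m m n) (1\<^sub>m m + B * A)" ..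
  have "four_block_mat (1\<^sub>m n + A * B) (- A) (0\<^sub>m m n) (1\<^sub>m m) * ?L =
      four_block_mat ((1\<^sub>m n + A * B) * 1\<^sub>m n + (- A) * B) ((1\<^sub>m n + A * B) * 0\<^sub>m n m + (- A) * 1\<^sub>m m)
        (0\<^sub>m m n * 1\<^sub>m n + 1\<^sub>m m * B) (0\<^sub>m m n * 0\<^sub>m n m + 1\<^sub>m m * 1\<^sub>m m)"
    using A B by (intro mult_four_block_mat) auto
  also have "(1\<^sub>m n + A * B) * 1\<^sub>m n + (- A) * B = 1\<^sub>m n"
    using A B AB by (intro eq_matI) auto
  also have "four_block_mat (1\<^sub>m n) ((1\<^sub>m n + A * B) * 0\<^sub>m n m + (- A) * 1\<^sub>m m)
        (0\<^sub>m m n * 1\<^sub>m n + 1\<^sub>m m * B) (0\<^sub>m m n * 0\<^sub>m n m + 1\<^sub>m m * 1\<^sub>m m) = ?M"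
    using A B AB by (intro cong_four_block_mat) auto
  finally have 2: "?M = four_block_mat (1\<^sub>m n + A * B) (- A) (0\<^sub>m m n) (1\<^sub>m m) * ?L" ..
  have L: "?L \<in> carrier_mat (n + m) (n + m)"
    using B by auto
  have detL: "Determinant.det ?L = 1"
    using B det_four_block_mat_upper_right_zero[of "1\<^sub>m n" n "0\<^sub>m n m" m B "1\<^sub>m m"] by simp
  let ?U1 = "four_block_mat (1\<^sub>m n) (- A) (0\<^sub>m m n) (1\<^sub>m m + B * A)"
  let ?U2 = "four_block_mat (1\<^sub>m n + A * B) (- A) (0\<^sub>m m n) (1\<^sub>m m)"
  have "Determinant.det ?M = Determinant.det ?L * Determinant.det ?U1"
    unfolding 1 by (rule det_mult[OF L]) (use A B in auto)
  also have "Determinant.det ?U1 = Determinant.det (1\<^sub>m n :: 'a Matrix.mat) * Determinant.det (1\<^sub>m m + B * A)"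
    by (rule det_four_block_mat_lower_left_zero[of _ n _ m]) (use A B in auto)
  finally have "Determinant.det ?M = Determinant.det (1\<^sub>m m + B * A)"
    by (simp add: detL)
  moreover have "Determinant.det ?M = Determinant.det ?U2 * Determinant.det ?L"
    unfolding 2 by (rule det_mult[OF _ L]) (use A B in auto)
  moreover have "Determinant.det ?U2 = Determinant.det (1\<^sub>m n + A * B) * Determinant.det (1\<^sub>m m :: 'a Matrix.mat)"
    by (rule det_four_block_mat_lower_left_zero[of _ n _ m]) (use A B in auto)
  ultimately show ?thesis by (simp add: detL)
qed

lemma det_mat_2:
  fixes f :: "nat \<times> nat \<Rightarrow> 'a :: idom"
  shows "Determinant.det (Matrix.mat 2 2 f) = f (0, 0) * f (1, 1) - f (0, 1) * f (1, 0)"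
proof -
  let ?b = "\<lambda>i j. Matrix.mat 1 1 (\<lambda>_. f (i, j))"
  have F: "Matrix.mat 2 2 f = four_block_mat (?b 0 0) (?b 0 1) (?b 1 0) (?b 1 1)"
  proof (rule eq_matI)
    fix i j assume "i < dim_row (four_block_mat (?b 0 0) (?b 0 1) (?b 1 0) (?b 1 1))"
      "j < dim_col (four_block_mat (?b 0 0) (?b 0 1) (?b 1 0) (?b 1 1))"
    then have "i < 2" "j < 2" by simp_all
    then show "Matrix.mat 2 2 f $$ (i, j) = four_block_mat (?b 0 0) (?b 0 1) (?b 1 0) (?b 1 1) $$ (i, j)"
      by (cases i; cases j) simp_all
  qed simp_all
  have "Determinant.det (Matrix.mat 2 2 f) = Determinant.det (?b 0 0 * ?b 1 1 - ?b 0 1 * ?b 1 0)"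
    unfolding F
  proof (rule det_four_block_mat[where n=1])
    show "?b 1 0 * ?b 1 1 = ?b 1 1 * ?b 1 0"
      by (rule eq_matI) (simp_all add: scalar_prod_def)
  qed (rule mat_carrier)+
  also have "?b 0 0 * ?b 1 1 - ?b 0 1 * ?b 1 0 = Matrix.mat 1 1 (\<lambda>_. f (0, 0) * f (1, 1) - f (0, 1) * f (1, 0))"
    by (rule eq_matI) (simp_all add: scalar_prod_def)
  also have "Determinant.det \<dots> = f (0, 0) * f (1, 1) - f (0, 1) * f (1, 0)"
    by (subst det_single[OF mat_carrier]) simp
  finally show ?thesis .
qed

text \<open>The matrix is \<open>1 + A * B\<close> times a diagonal matrix, where \<open>A\<close>
  has the columns \<open>1\<close> and \<open>f\<close> and \<open>B\<close> the rows
  \<open>d\<close> and \<open>g * d\<close>. Sylvester's identity leaves a determinant of size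
  two.\<close>

lemma det_diag_plus_rank_two:
  fixes D s f g :: "nat \<Rightarrow> real"
  assumes D: "\<And>i. i < n \<Longrightarrow> D i \<noteq> 0"
  defines "d \<equiv> \<lambda>i. s i / D i"
  shows "Determinant.det (Matrix.mat n n (\<lambda>(i, j). (if i = j then D i else 0) + (1 + f i * g j) * s j)) =
    (\<Prod>i<n. D i) * ((1 + (\<Sum>i<n. d i)) * (1 + (\<Sum>i<n. f i * g i * d i)) - (\<Sum>i<n. f i * d i) * (\<Sum>i<n. g i * d i))"
proof -
  define A where "A = Matrix.mat n 2 (\<lambda>(i, k). if k = 0 then 1 else f i)"
  define B where "B = Matrix.mat 2 n (\<lambda>(k, j). if k = 0 then d j else g j * d j)"
  have A: "A \<in> carrier_mat n 2" and B: "B \<in> carrier_mat 2 n"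
    by (auto simp: A_def B_def)
  have "Matrix.mat n n (\<lambda>(i, j). (if i = j then D i else 0) + (1 + f i * g j) * s j) =
      (1\<^sub>m n + A * B) * mat_diag n D"
  proof (subst mat_diag_mult_right[of _ n])
    show "1\<^sub>m n + A * B \<in> carrier_mat n n" using A B by auto
    show "Matrix.mat n n (\<lambda>(i, j). (if i = j then D i else 0) + (1 + f i * g j) * s j) =
        Matrix.mat n n (\<lambda>(i, j). (1\<^sub>m n + A * B) $$ (i, j) * D j)"
    proof (intro eq_matI)
      fix i j assume "i < dim_row (Matrix.mat n n (\<lambda>(i, j). (1\<^sub>m n + A * B) $$ (i, j) * D j))"
        "j < dim_col (Matrix.mat n n (\<lambda>(i, j). (1\<^sub>m n + A * B) $$ (i, j) * D j))"
      then have ij: "i < n" "j < n" by auto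
      have "(1\<^sub>m n + A * B) $$ (i, j) * D j = ((if i = j then 1 else 0) + (d j + f i * (g j * d j))) * D j"
        using ij by (simp add: A_def B_def scalar_prod_def numeral_2_eq_2)
      also have "\<dots> = (if i = j then D i else 0) + (1 + f i * g j) * (d j * D j)"
        by (simp add: algebra_simps)
      also have "d j * D j = s j"
        using D ij by (simp add: d_def)
      finally show "Matrix.mat n n (\<lambda>(i, j). (if i = j then D i else 0) + (1 + f i * g j) * s j) $$ (i, j) =
          Matrix.mat n n (\<lambda>(i, j). (1\<^sub>m n + A * B) $$ (i, j) * D j) $$ (i, j)"
        using ij by simp
    qed auto
  qed
  also have "Determinant.det \<dots> = Determinant.det (1\<^sub>m n + A * B) * Determinant.det (mat_diag n D)"
    using A B by (intro det_mult[of _ n]) auto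
  also have "Determinant.det (mat_diag n D) = (\<Prod>i<n. D i)"
    by (subst det_lower_triangular[of n])
      (auto simp: mat_diag_def diag_mat_def prod.distinct_set_conv_list[symmetric] atLeast0LessThan)
  also have "Determinant.det (1\<^sub>m n + A * B) = Determinant.det (1\<^sub>m 2 + B * A)"
    by (rule det_one_plus_mult_commute[OF A B])
  also have "1\<^sub>m 2 + B * A = Matrix.mat 2 2 (\<lambda>(k, l). (if k = l then 1 else 0) +
      (\<Sum>i<n. (if k = 0 then d i else g i * d i) * (if l = 0 then 1 else f i)))"
    by (intro eq_matI) (auto simp: A_def B_def scalar_prod_def atLeast0LessThan)
  finally show ?thesis
    by (simp add: det_mat_2 mult_ac)
qed

section \<open>The rank-two kernel\<close>

lemma negative_binomial_sums:
  fixes a x y :: real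
  assumes "0 \<le> y" "y < x"
  shows "(\<lambda>k. pochhammer a k / fact k * y ^ k * x powr - (a + real k)) sums (x - y) powr - a"
proof -
  have "(\<lambda>k. (- a gchoose k) * x powr (- a - real k) * (- y) ^ k) sums (x + - y) powr - a"
    using assms by (intro gen_binomial_real'') auto
  moreover have "(- a gchoose k) * x powr (- a - real k) * (- y) ^ k =
      pochhammer a k / fact k * y ^ k * x powr - (a + real k)" for k
  proof -
    \<comment> \<open>The sign of \<open>- a gchoose k\<close> cancels that of
      \<open>(- y) ^ k\<close>; for \<open>a > 0\<close> all terms are therefore
      nonnegative.\<close>
    have "(- 1) ^ k * (- y) ^ k = y ^ k"
      by (simp add: power_mult_distrib[symmetric])
    then show ?thesis
      by (simp add: gbinomial_pochhammer mult_ac)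
  qed
  ultimately show ?thesis by simp
qed

text \<open>The sequence with \<open>l\<close> times a standard exponential variable at
  \<open>k\<close> and 0 elsewhere: shape 1 at \<open>k\<close>, shape 0 at the others.\<close>

lemma realizable_site:
  assumes "0 \<le> (l :: real)"
  shows "realizable (\<lambda>J s. if k \<in> J then 1 / (1 + l * s k) else 1)"
proof (rule realizable_cong)
  show "realizable (\<lambda>J s. \<Prod>i\<in>J. (1 + l * s i) powr - (if i = k then 1 else 0))"
    using assms by (intro realizable_prod_powr) auto
  fix J and s :: "nat \<Rightarrow> real" assume J: "finite J" and s: "\<And>i. i \<in> J \<Longrightarrow> 0 \<le> s i"
  have pos: "0 < 1 + l * s i" if "i \<in> J" for i
    using assms s[OF that] by (simp add: add_pos_nonneg)
  have "(\<Prod>i\<in>J. (1 + l * s i) powr - (if i = k then 1 else 0)) =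
      (\<Prod>i\<in>J. if i = k then 1 / (1 + l * s i) else 1)"
    using pos less_imp_le[OF pos] less_imp_neq[OF pos]
    by (intro prod.cong refl) (auto simp: powr_minus divide_inverse)
  then show "(\<Prod>i\<in>J. (1 + l * s i) powr - (if i = k then 1 else 0)) =
      (if k \<in> J then 1 / (1 + l * s k) else 1)"
    using J by simp
qed

text \<open>Since \<open>1 / (1 + l * s) = 1 - l * s / (1 + l * s)\<close>, the series differs from
  that of \<open>w\<close> by a finite sum over \<open>J\<close>.\<close>

lemma sums_site:
  fixes w l s :: "nat \<Rightarrow> real"
  assumes "w sums W" "finite J" "\<And>i. i \<in> J \<Longrightarrow> 0 \<le> s i" "\<And>i. 0 \<le> l i"
  shows "(\<lambda>i. w i * (if i \<in> J then 1 / (1 + l i * s i) else 1)) sums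
    (W - (\<Sum>i\<in>J. w i * l i * (s i / (1 + l i * s i))))"
proof -
  have "(\<lambda>i. w i - (if i \<in> J then w i * l i * (s i / (1 + l i * s i)) else 0)) sums
      (W - (\<Sum>i\<in>J. w i * l i * (s i / (1 + l i * s i))))"
    using assms by (intro sums_diff sums_If_finite_set)
  moreover have "w i - (if i \<in> J then w i * l i * (s i / (1 + l i * s i)) else 0) =
      w i * (if i \<in> J then 1 / (1 + l i * s i) else 1)" for i
  proof (cases "i \<in> J")
    case True
    have "0 < 1 + l i * s i" using assms True by (simp add: add_pos_nonneg)
    then show ?thesis using True by (simp add: field_simps)
  qed simp
  ultimately show ?thesis by simp
qed

text \<open>A site \<open>k\<close> is drawn with probability \<open>w k / W\<close> and carries the
  exponential variable.\<close>

lemma realizable_sites: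
  assumes w: "\<And>i. 0 \<le> w i" "w sums W" "0 < W" and l: "\<And>i. 0 \<le> l i"
  shows "realizable (\<lambda>J s. (W - (\<Sum>i\<in>J. w i * l i * (s i / (1 + l i * s i)))) / W)"
proof (rule realizable_suminf)
  show "0 \<le> w k / W" for k using w by simp
  show "(\<lambda>k. w k / W) sums 1"
    using sums_divide[OF w(2), of W] w(3) by simp
  show "realizable (\<lambda>J s. if k \<in> J then 1 / (1 + l k * s k) else 1)" for k
    by (intro realizable_site l)
  fix J and s :: "nat \<Rightarrow> real" assume J: "finite J" and s: "\<And>i. i \<in> J \<Longrightarrow> 0 \<le> s i"
  show "0 \<le> (if k \<in> J then 1 / (1 + l k * s k) else 1)" for k
    using l s by (simp add: add_nonneg_nonneg)
  show "(\<lambda>k. w k / W * (if k \<in> J then 1 / (1 + l k * s k) else 1)) sums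
      ((W - (\<Sum>i\<in>J. w i * l i * (s i / (1 + l i * s i)))) / W)"
    using sums_divide[OF sums_site[where s = s and l = l, OF w(2) J s l], of W] by simp
qed

text \<open>Here \<open>l\<close>, \<open>u\<close> and \<open>v\<close> stand for the \<open>\<lambda>\<close>, \<open>1 - f\<close> and \<open>1 - g\<close> of the paper.
  The point \<open>0\<close> is covered by \<open>l = u = v = 0\<close>, where \<open>u / l\<close> is \<open>0 / 0 = 0\<close>.\<close>

locale rank_two_data =
  fixes l u v :: "nat \<Rightarrow> real" and F G :: real
  assumes l: "\<And>i. 0 \<le> l i"
    and u: "\<And>i. 0 \<le> u i" "\<And>i. u i \<le> 1" and v: "\<And>i. 0 \<le> v i" "\<And>i. v i \<le> 1"
    and l_zero: "\<And>i. l i = 0 \<Longrightarrow> u i = 0 \<and> v i = 0"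
    and F: "(\<lambda>i. u i / l i) sums F" "0 < F" "F < 1"
    and G: "(\<lambda>i. v i / l i) sums G" "0 < G" "G < 1"
begin

definition "H = (\<Sum>i. u i * v i / l i)"
text \<open>The values of \<open>p\<close> and \<open>q\<close> are those for which \<open>1 + \<Sum> u d = p Q - X\<close> and
  \<open>1 + \<Sum> v d = q Q - Y\<close> below, where \<open>X\<close> and \<open>Y\<close> are sums of terms
  \<open>1 / (1 + l i * s i)\<close> with nonnegative weights and without constant term.\<close>

definition "p = (1 + F) / (2 + H)"
definition "q = (1 + G) / (2 + H)"

lemma H: "(\<lambda>i. u i * v i / l i) sums H" "0 \<le> H" "H \<le> F" "H \<le> G"
proof -
  have le: "u i * v i / l i \<le> u i / l i" "u i * v i / l i \<le> v i / l i" "0 \<le> u i * v i / l i" for i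
    using u[of i] v[of i] l[of i]
    by (auto intro!: divide_right_mono mult_left_le mult_left_le_one_le divide_nonneg_nonneg)
  have "norm (u i * v i / l i) \<le> u i / l i" for i
    using le(1,3)[of i] by (simp only: real_norm_def abs_of_nonneg)
  then have "summable (\<lambda>i. u i * v i / l i)"
    by (intro summable_comparison_test'[OF sums_summable[OF F(1)]])
  then show H: "(\<lambda>i. u i * v i / l i) sums H"
    unfolding H_def by (rule summable_sums)
  show "0 \<le> H" by (rule sums_le[OF le(3) sums_zero H])
  show "H \<le> F" by (rule sums_le[OF le(1) H F(1)])
  show "H \<le> G" by (rule sums_le[OF le(2) H G(1)])
qed

text \<open>The lower bounds come from \<open>H \<le> F\<close> and \<open>H \<le> G\<close> with
  \<open>F\<close> and \<open>G\<close> positive, the upper ones from \<open>F < 1\<close> and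
  \<open>G < 1\<close> with \<open>0 \<le> H\<close>. The upper bounds keep
  \<open>1 - p * v i\<close> and \<open>1 - q * u i\<close> nonnegative.\<close>

lemma pq: "1 / 2 < p" "p < 1" "1 / 2 < q" "q < 1"
  using F G H by (auto simp: p_def q_def field_simps)

lemma coeff_nonneg: "0 \<le> 1 - p * v i" "0 \<le> 1 - q * u i"
  using pq u[of i] v[of i] by (auto intro!: mult_le_one)

text \<open>\<open>p\<close> solves \<open>F - p * H = 2 * p - 1\<close>. These weights times
  \<open>l i\<close> are the coefficients in \<open>X\<close>, so their total matches the constant
  in \<open>X\<close> and the expansion of \<open>X\<close> over sites has no constant term.\<close>

lemma p_weights: "(\<lambda>i. u i * (1 - p * v i) / l i) sums (2 * p - 1)"
proof -
  have "(\<lambda>i. u i / l i - p * (u i * v i / l i)) sums (F - p * H)"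
    by (intro sums_diff sums_mult F H)
  moreover have "F - p * H = 2 * p - 1"
    using H(2) by (simp add: p_def field_simps)
  moreover have "u i / l i - p * (u i * v i / l i) = u i * (1 - p * v i) / l i" for i
    by (simp add: algebra_simps diff_divide_distrib)
  ultimately show ?thesis by (simp only:)
qed

lemma q_weights: "(\<lambda>i. v i * (1 - q * u i) / l i) sums (2 * q - 1)"
proof -
  have "(\<lambda>i. v i / l i - q * (u i * v i / l i)) sums (G - q * H)"
    by (intro sums_diff sums_mult G H)
  moreover have "G - q * H = 2 * q - 1"
    using H(2) by (simp add: q_def field_simps)
  moreover have "v i / l i - q * (u i * v i / l i) = v i * (1 - q * u i) / l i" for i
    by (simp add: algebra_simps diff_divide_distrib)
  ultimately show ?thesis by (simp only:)
qed

text \<open>The value that makes \<open>Q * R - X * Y\<close> equal to 1 at \<open>s = 0\<close>, as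
  \<open>reduced_det\<close> is there.\<close>

definition "r = 1 - p - q + 2 * p * q"

lemma r: "2 * r - (2 * p - 1) * (2 * q - 1) = 1"
  by (simp add: r_def algebra_simps)

lemma r_pos: "0 < r"
proof -
  have "0 < (2 * p - 1) * (2 * q - 1)" using pq by (intro mult_pos_pos) auto
  then show ?thesis using r by linarith
qed

section \<open>Splitting of the reduced determinant\<close>

definition "dd s i = s i / (1 + l i * s i)"
definition "X J s = 2 * p - 1 - (\<Sum>i\<in>J. u i * (1 - p * v i) * dd s i)"
definition "Y J s = 2 * q - 1 - (\<Sum>i\<in>J. v i * (1 - q * u i) * dd s i)"
definition "Q J s = 2 + (\<Sum>i\<in>J. u i * v i * dd s i)"
definition "R J s = r + (\<Sum>i\<in>J. (1 - p * v i) * (1 - q * u i) * dd s i)"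
definition "reduced_det J s = (1 + (\<Sum>i\<in>J. dd s i)) * Q J s -
  (1 + (\<Sum>i\<in>J. u i * dd s i)) * (1 + (\<Sum>i\<in>J. v i * dd s i))"

text \<open>Insert \<open>1 + \<Sum> u d = p * Q - X\<close> and
  \<open>1 + \<Sum> v d = q * Q - Y\<close>. The terms with factor \<open>Q\<close> leave
  \<open>R = 1 + \<Sum> d - p * q * Q + p * Y + q * X\<close>, whose coefficients factor as
  \<open>(1 - p * v i) * (1 - q * u i)\<close>.\<close>

lemma reduced_det_eq: "reduced_det J s = Q J s * R J s - X J s * Y J s"
proof -
  define a where "a = (\<Sum>i\<in>J. dd s i)"
  define x where "x = (\<Sum>i\<in>J. u i * dd s i)"
  define y where "y = (\<Sum>i\<in>J. v i * dd s i)"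
  define z where "z = (\<Sum>i\<in>J. u i * v i * dd s i)"
  have X: "X J s = 2 * p - 1 - x + p * z"
    by (simp add: X_def x_def z_def algebra_simps sum_subtractf sum_distrib_left)
  have Y: "Y J s = 2 * q - 1 - y + q * z"
    by (simp add: Y_def y_def z_def algebra_simps sum_subtractf sum_distrib_left)
  have R: "R J s = r + a - p * y - q * x + p * q * z"
    by (simp add: R_def a_def x_def y_def z_def algebra_simps sum_subtractf sum.distrib sum_distrib_left)
  have Q: "Q J s = 2 + z" by (simp add: Q_def z_def)
  show ?thesis
    unfolding reduced_det_def a_def[symmetric] x_def[symmetric] y_def[symmetric] X Y R Q r_def
    by (simp add: algebra_simps)
qed

context
  fixes J :: "nat set" and s :: "nat \<Rightarrow> real"
  assumes J: "finite J" and s: "\<forall>i\<in>J. 0 \<le> s i"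
begin

lemma dd_nonneg: "i \<in> J \<Longrightarrow> 0 \<le> dd s i"
  using s l by (simp add: dd_def)

text \<open>\<open>X\<close> is a series of nonnegative weights, each times
  \<open>1 / (1 + l i * s i)\<close> or 1. The upper bound is its value at
  \<open>s = 0\<close>.\<close>

lemma X_bounds: "0 \<le> X J s" "X J s \<le> 2 * p - 1"
proof -
  \<comment> \<open>The division by \<open>l i\<close> can be undone also for
    \<open>l i = 0\<close>, because \<open>u i = 0\<close> there.\<close>
  have *: "u i * (1 - p * v i) / l i * l i = u i * (1 - p * v i)" for i
    using l_zero[of i] by auto
  have "0 \<le> 2 * p - 1 - (\<Sum>i\<in>J. u i * (1 - p * v i) / l i * l i * (s i / (1 + l i * s i)))"
    by (rule sums_le[OF _ sums_zero sums_site[OF p_weights J bspec[OF s] l]])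
      (use s u l coeff_nonneg in \<open>simp_all add: add_nonneg_nonneg\<close>)
  then show "0 \<le> X J s" by (simp only: X_def dd_def *)
  show "X J s \<le> 2 * p - 1"
    using u coeff_nonneg dd_nonneg by (auto simp: X_def intro!: sum_nonneg mult_nonneg_nonneg)
qed

lemma Y_bounds: "0 \<le> Y J s" "Y J s \<le> 2 * q - 1"
proof -
  have *: "v i * (1 - q * u i) / l i * l i = v i * (1 - q * u i)" for i
    using l_zero[of i] by auto
  have "0 \<le> 2 * q - 1 - (\<Sum>i\<in>J. v i * (1 - q * u i) / l i * l i * (s i / (1 + l i * s i)))"
    by (rule sums_le[OF _ sums_zero sums_site[OF q_weights J bspec[OF s] l]])
      (use s v l coeff_nonneg in \<open>simp_all add: add_nonneg_nonneg\<close>)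
  then show "0 \<le> Y J s" by (simp only: Y_def dd_def *)
  show "Y J s \<le> 2 * q - 1"
    using v coeff_nonneg dd_nonneg by (auto simp: Y_def intro!: sum_nonneg mult_nonneg_nonneg)
qed

lemma Q_ge: "2 \<le> Q J s"
  using u v dd_nonneg by (auto simp: Q_def intro!: sum_nonneg mult_nonneg_nonneg)

lemma R_ge: "r \<le> R J s"
  using coeff_nonneg dd_nonneg by (auto simp: R_def intro!: sum_nonneg mult_nonneg_nonneg)

text \<open>The condition for the binomial series. \<open>X\<close> and \<open>Y\<close> are largest
  and \<open>Q\<close> and \<open>R\<close> smallest at \<open>s = 0\<close>, where the gap is
  \<open>2 * r - (2 * p - 1) * (2 * q - 1) = 1\<close>.\<close>

lemma XY_bounds: "0 \<le> X J s * Y J s" "X J s * Y J s < Q J s * R J s"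
proof -
  show "0 \<le> X J s * Y J s" using X_bounds Y_bounds by simp
  have "X J s * Y J s \<le> (2 * p - 1) * (2 * q - 1)"
    using X_bounds Y_bounds pq by (intro mult_mono) auto
  also have "\<dots> < 2 * r" using r by linarith
  also have "\<dots> \<le> Q J s * R J s"
    using Q_ge R_ge r_pos by (intro mult_mono) auto
  finally show "X J s * Y J s < Q J s * R J s" .
qed

end

section \<open>Realization of the factors and of the determinant\<close>

lemma realizable_X: "realizable (\<lambda>J s. X J s / (2 * p - 1))"
proof (rule realizable_cong)
  show "realizable (\<lambda>J s. (2 * p - 1 -
      (\<Sum>i\<in>J. u i * (1 - p * v i) / l i * l i * (s i / (1 + l i * s i)))) / (2 * p - 1))"
    using u l coeff_nonneg pq by (intro realizable_sites p_weights) auto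
  have *: "u i * (1 - p * v i) / l i * l i = u i * (1 - p * v i)" for i
    using l_zero[of i] by auto
  show "(2 * p - 1 - (\<Sum>i\<in>J. u i * (1 - p * v i) / l i * l i * (s i / (1 + l i * s i)))) / (2 * p - 1) =
      X J s / (2 * p - 1)" for J s
    by (simp only: X_def dd_def *)
qed

lemma realizable_Y: "realizable (\<lambda>J s. Y J s / (2 * q - 1))"
proof (rule realizable_cong)
  show "realizable (\<lambda>J s. (2 * q - 1 -
      (\<Sum>i\<in>J. v i * (1 - q * u i) / l i * l i * (s i / (1 + l i * s i)))) / (2 * q - 1))"
    using v l coeff_nonneg pq by (intro realizable_sites q_weights) auto
  have *: "v i * (1 - q * u i) / l i * l i = v i * (1 - q * u i)" for i
    using l_zero[of i] by auto
  show "(2 * q - 1 - (\<Sum>i\<in>J. v i * (1 - q * u i) / l i * l i * (s i / (1 + l i * s i)))) / (2 * q - 1) =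
      Y J s / (2 * q - 1)" for J s
    by (simp only: Y_def dd_def *)
qed

lemma realizable_Q:
  assumes "0 < \<beta>"
  shows "realizable (\<lambda>J s. (Q J s / 2) powr - \<beta>)"
proof (rule realizable_cong)
  let ?c = "\<lambda>i. u i * v i / 2"
  show "realizable (\<lambda>J s. (1 + (\<Sum>i\<in>J. ?c i * s i / (1 + l i * s i))) powr - \<beta>)"
    using assms u v l coeff_nonneg r_pos by (intro realizable_sum_powr) simp_all
  show "(1 + (\<Sum>i\<in>J. ?c i * s i / (1 + l i * s i))) powr - \<beta> = (Q J s / 2) powr - \<beta>" for J s
    using r_pos by (simp add: Q_def dd_def add_divide_distrib sum_divide_distrib mult_ac)
qed

lemma realizable_R:
  assumes "0 < \<beta>"
  shows "realizable (\<lambda>J s. (R J s / r) powr - \<beta>)"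
proof (rule realizable_cong)
  let ?c = "\<lambda>i. (1 - p * v i) * (1 - q * u i) / r"
  show "realizable (\<lambda>J s. (1 + (\<Sum>i\<in>J. ?c i * s i / (1 + l i * s i))) powr - \<beta>)"
    using assms u v l coeff_nonneg r_pos by (intro realizable_sum_powr) simp_all
  show "(1 + (\<Sum>i\<in>J. ?c i * s i / (1 + l i * s i))) powr - \<beta> = (R J s / r) powr - \<beta>" for J s
    using r_pos by (simp add: R_def dd_def add_divide_distrib sum_divide_distrib mult_ac)
qed

lemma realizable_reduced_det:
  assumes \<alpha>: "\<alpha> > 0"
  shows "realizable (\<lambda>J s. reduced_det J s powr - \<alpha>)"
proof (rule realizable_suminf)
  let ?x = "2 * p - 1" and ?y = "2 * q - 1"
  \<comment> \<open>Each factor is normalized by its value at \<open>s = 0\<close>; the constants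
    are collected in \<open>c k\<close>.\<close>
  define c where "c k = pochhammer \<alpha> k / fact k * (?x * ?y) ^ k * (2 * r) powr - (\<alpha> + real k)" for k
  define \<phi> where "\<phi> k J s = (X J s / ?x) ^ k * ((Y J s / ?y) ^ k *
    ((Q J s / 2) powr - (\<alpha> + real k) * (R J s / r) powr - (\<alpha> + real k)))" for k J s
  have xy: "0 < ?x" "0 < ?y" using pq by auto
  show "0 \<le> c k" for k
    using xy \<alpha> pochhammer_pos[OF \<alpha>, of k] by (simp add: c_def)
  \<comment> \<open>The coefficients are the binomial series of
    \<open>(2 * r - ?x * ?y) powr - \<alpha>\<close>, whose base is 1.\<close>
  have "?x * ?y < 2 * r" using r by linarith
  then show "c sums 1"
    using negative_binomial_sums[of "?x * ?y" "2 * r" \<alpha>] xy r unfolding c_def by simp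
  show "realizable (\<phi> k)" for k
    unfolding \<phi>_def using \<alpha> xy X_bounds Y_bounds
    by (intro realizable_mult realizable_power realizable_X realizable_Y realizable_Q realizable_R) auto
  fix J and s :: "nat \<Rightarrow> real" assume "finite J" "\<And>i. i \<in> J \<Longrightarrow> 0 \<le> s i"
  then have Js: "finite J" "\<forall>i\<in>J. 0 \<le> s i" by auto
  show "0 \<le> \<phi> k J s" for k
    using X_bounds[OF Js] Y_bounds[OF Js] xy by (simp add: \<phi>_def)
  have pos: "0 < Q J s" "0 < R J s" using Q_ge[OF Js] R_ge[OF Js] r_pos by auto
  have "c k * \<phi> k J s = pochhammer \<alpha> k / fact k * (X J s * Y J s) ^ k * (Q J s * R J s) powr - (\<alpha> + real k)" for k
  proof -
    have "(2 * r) powr - (\<alpha> + real k) * ((Q J s / 2) powr - (\<alpha> + real k) * (R J s / r) powr - (\<alpha> + real k)) =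
        (2 * r * (Q J s / 2 * (R J s / r))) powr - (\<alpha> + real k)"
      using pos r_pos by (simp add: powr_mult powr_divide)
    also have "2 * r * (Q J s / 2 * (R J s / r)) = Q J s * R J s"
      using r_pos by simp
    finally have 1: "(2 * r) powr - (\<alpha> + real k) *
        ((Q J s / 2) powr - (\<alpha> + real k) * (R J s / r) powr - (\<alpha> + real k)) =
        (Q J s * R J s) powr - (\<alpha> + real k)" .
    have "(?x * ?y) ^ k * ((X J s / ?x) ^ k * (Y J s / ?y) ^ k) = (?x * ?y * (X J s / ?x * (Y J s / ?y))) ^ k"
      by (simp only: power_mult_distrib)
    also have "?x * ?y * (X J s / ?x * (Y J s / ?y)) = X J s * Y J s"
      using xy by simp
    finally have 2: "(?x * ?y) ^ k * ((X J s / ?x) ^ k * (Y J s / ?y) ^ k) = (X J s * Y J s) ^ k" .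
    have "c k * \<phi> k J s = pochhammer \<alpha> k / fact k * ((?x * ?y) ^ k * ((X J s / ?x) ^ k * (Y J s / ?y) ^ k)) *
        ((2 * r) powr - (\<alpha> + real k) * ((Q J s / 2) powr - (\<alpha> + real k) * (R J s / r) powr - (\<alpha> + real k)))"
      unfolding c_def \<phi>_def by (simp only: mult_ac)
    then show ?thesis unfolding 1 2 .
  qed
  then show "(\<lambda>k. c k * \<phi> k J s) sums (reduced_det J s powr - \<alpha>)"
    using negative_binomial_sums[OF XY_bounds[OF Js]] by (simp add: reduced_det_eq)
qed

text \<open>The product over \<open>J\<close> comes from independent gamma variables of shape
  \<open>\<alpha>\<close> and scales \<open>l i\<close>, added independently.\<close>

lemma realizable_det:
  assumes \<alpha>: "\<alpha> > 0"
  shows "realizable (\<lambda>J s. ((\<Prod>i\<in>J. 1 + l i * s i) * reduced_det J s) powr - \<alpha>)"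
proof (rule realizable_cong)
  show "realizable (\<lambda>J s. (\<Prod>i\<in>J. (1 + l i * s i) powr - \<alpha>) * reduced_det J s powr - \<alpha>)"
    using \<alpha> l by (intro realizable_mult realizable_prod_powr realizable_reduced_det prod_nonneg) auto
  fix J and s :: "nat \<Rightarrow> real" assume "finite J" "\<And>i. i \<in> J \<Longrightarrow> 0 \<le> s i"
  then have Js: "finite J" "\<forall>i\<in>J. 0 \<le> s i" by auto
  have "0 \<le> 1 + l i * s i" if "i \<in> J" for i using Js l that by simp
  then have "0 \<le> (\<Prod>i\<in>J. 1 + l i * s i)" "(\<Prod>i\<in>J. (1 + l i * s i) powr - \<alpha>) = (\<Prod>i\<in>J. 1 + l i * s i) powr - \<alpha>"
    by (auto simp: prod_powr_distrib intro: prod_nonneg)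
  moreover have "0 \<le> reduced_det J s"
    using XY_bounds[OF Js] by (simp add: reduced_det_eq)
  ultimately show "(\<Prod>i\<in>J. (1 + l i * s i) powr - \<alpha>) * reduced_det J s powr - \<alpha> =
      ((\<Prod>i\<in>J. 1 + l i * s i) * reduced_det J s) powr - \<alpha>"
    by (simp add: powr_mult)
qed

end

section \<open>The determinant for finitely many points\<close>

lemma (in rank_two_data) det_eq:
  fixes \<tau> :: "nat \<Rightarrow> nat" and s s' :: "nat \<Rightarrow> real"
  assumes \<tau>: "inj_on \<tau> {..<n}" and s: "\<And>i. i < n \<Longrightarrow> 0 \<le> s i"
    and s': "\<And>i. i < n \<Longrightarrow> s' (\<tau> i) = s i"
    and K: "\<And>i j. i < n \<Longrightarrow> j < n \<Longrightarrow>
      K i j = (if i = j then l (\<tau> i) else 0) + 1 + (1 - u (\<tau> i)) * (1 - v (\<tau> j))"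
  shows "Determinant.det (1\<^sub>m n + Matrix.mat n n (\<lambda>(i, j). K i j) * mat_diag n s) =
    (\<Prod>i\<in>\<tau> ` {..<n}. 1 + l i * s' i) * reduced_det (\<tau> ` {..<n}) s'"
proof -
  define D where "D i = 1 + l (\<tau> i) * s i" for i
  have D: "0 < D i" if "i < n" for i
    using s[OF that] l by (simp add: D_def add_pos_nonneg)
  define d where "d i = s i / D i" for i
  have d: "dd s' (\<tau> i) = d i" if "i < n" for i
    using s'[OF that] by (simp add: dd_def D_def d_def)
  have mat: "1\<^sub>m n + Matrix.mat n n (\<lambda>(i, j). K i j) * mat_diag n s =
      Matrix.mat n n (\<lambda>(i, j). (if i = j then D i else 0) + (1 + (1 - u (\<tau> i)) * (1 - v (\<tau> j))) * s j)"
    unfolding mat_diag_mult_right[OF mat_carrier]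
    by (rule eq_matI) (simp_all add: K D_def algebra_simps)
  have "Determinant.det (1\<^sub>m n + Matrix.mat n n (\<lambda>(i, j). K i j) * mat_diag n s) = (\<Prod>i<n. D i) *
      ((1 + (\<Sum>i<n. d i)) * (1 + (\<Sum>i<n. (1 - u (\<tau> i)) * (1 - v (\<tau> i)) * d i)) -
        (\<Sum>i<n. (1 - u (\<tau> i)) * d i) * (\<Sum>i<n. (1 - v (\<tau> i)) * d i))"
    unfolding mat d_def using D by (intro det_diag_plus_rank_two) (simp add: less_imp_neq[symmetric])
  also have "(\<Prod>i<n. D i) = (\<Prod>i\<in>\<tau> ` {..<n}. 1 + l i * s' i)"
    by (simp add: prod.reindex[OF \<tau>] s' D_def)
  also have "(1 + (\<Sum>i<n. d i)) * (1 + (\<Sum>i<n. (1 - u (\<tau> i)) * (1 - v (\<tau> i)) * d i)) -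
        (\<Sum>i<n. (1 - u (\<tau> i)) * d i) * (\<Sum>i<n. (1 - v (\<tau> i)) * d i) = reduced_det (\<tau> ` {..<n}) s'"
  proof -
    \<comment> \<open>In these variables the claim is \<open>(1 + a) * (1 + a - x - y + z) - (a - x)
      * (a - y) = (1 + a) * (2 + z) - (1 + x) * (1 + y)\<close>; the squares of \<open>a\<close>
      cancel.\<close>
    define a where "a = (\<Sum>i<n. d i)"
    define x where "x = (\<Sum>i<n. u (\<tau> i) * d i)"
    define y where "y = (\<Sum>i<n. v (\<tau> i) * d i)"
    define z where "z = (\<Sum>i<n. u (\<tau> i) * v (\<tau> i) * d i)"
    have 1: "(\<Sum>i<n. (1 - u (\<tau> i)) * (1 - v (\<tau> i)) * d i) = a - x - y + z"
      by (simp add: a_def x_def y_def z_def algebra_simps sum.distrib sum_subtractf)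
    have 2: "(\<Sum>i<n. (1 - u (\<tau> i)) * d i) = a - x" "(\<Sum>i<n. (1 - v (\<tau> i)) * d i) = a - y"
      by (simp_all add: a_def x_def y_def algebra_simps sum_subtractf)
    have 3: "reduced_det (\<tau> ` {..<n}) s' = (1 + a) * (2 + z) - (1 + x) * (1 + y)"
      by (simp add: reduced_det_def Q_def sum.reindex[OF \<tau>] a_def x_def y_def z_def d)
    show ?thesis
      unfolding 1 2 3 a_def[symmetric] by (simp add: algebra_simps)
  qed
  finally show ?thesis .
qed

section \<open>The process on \<open>T\<close>\<close>

theorem theorem1p1:
  fixes T :: "real set"
    and lam f g :: "nat \<Rightarrow> real"
    and U :: "real \<Rightarrow> real \<Rightarrow> real"
  assumes T: "T = {0} \<union> {1 / real n | n. n \<ge> 2}"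
    and lam_pos: "\<And>j. j \<ge> 2 \<Longrightarrow> lam j > 0"
    and f_range: "\<And>j. j \<ge> 2 \<Longrightarrow> 0 < f j \<and> f j < 1"
    and g_range: "\<And>j. j \<ge> 2 \<Longrightarrow> 0 < g j \<and> g j < 1"
    and lam_lim: "lam \<longlonglongrightarrow> 0"
    and f_summable: "summable (\<lambda>j. (1 - f (j + 2)) / lam (j + 2))"
    and f_sum: "(\<Sum>j. (1 - f (j + 2)) / lam (j + 2)) < 1"
    and g_summable: "summable (\<lambda>j. (1 - g (j + 2)) / lam (j + 2))"
    and g_sum: "(\<Sum>j. (1 - g (j + 2)) / lam (j + 2)) < 1"
    and U_00: "U 0 0 = 2"
    and U_0j: "\<And>j. j \<ge> 2 \<Longrightarrow> U 0 (1 / real j) = 1 + g j"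
    and U_i0: "\<And>i. i \<ge> 2 \<Longrightarrow> U (1 / real i) 0 = 1 + f i"
    and U_ij: "\<And>i j. i \<ge> 2 \<Longrightarrow> j \<ge> 2 \<Longrightarrow>
      U (1 / real i) (1 / real j) = (if i = j then lam i else 0) + 1 + f i * g j"
  shows "\<forall>\<alpha>>0. \<exists>(M :: (real \<Rightarrow> real) measure) (X :: real \<Rightarrow> (real \<Rightarrow> real) \<Rightarrow> real).
    permanental_process M \<alpha> T U X"
proof (intro allI impI)
  fix \<alpha> :: real assume \<alpha>: "\<alpha> > 0"
  \<comment> \<open>Index 0 encodes the point 0 and \<open>n \<ge> 2\<close> the point
    \<open>1 / n\<close>; index 1 encodes no point and gets the same zero values.\<close>
  define l where "l n = (if n < 2 then 0 else lam n)" for n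
  define u where "u n = (if n < 2 then 0 else 1 - f n)" for n
  define v where "v n = (if n < 2 then 0 else 1 - g n)" for n
  have sums: "(\<lambda>n. (if n < 2 then 0 else 1 - h n) / l n) sums (\<Sum>j. (1 - h (j + 2)) / lam (j + 2))"
    "0 < (\<Sum>j. (1 - h (j + 2)) / lam (j + 2))"
    if h: "\<And>j. j \<ge> 2 \<Longrightarrow> h j < 1" and summable: "summable (\<lambda>j. (1 - h (j + 2)) / lam (j + 2))"
    for h :: "nat \<Rightarrow> real"
  proof -
    let ?a = "\<lambda>n. (if n < 2 then 0 else 1 - h n) / l n"
    have "(\<lambda>n. ?a (n + 2)) sums (\<Sum>j. (1 - h (j + 2)) / lam (j + 2))"
      using summable_sums[OF summable] by (simp add: l_def)
    \<comment> \<open>The first two terms are \<open>0 / 0 = 0\<close>, so the series from 0 agrees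
      with the one from 2.\<close>
    moreover have "(\<Sum>i<2. ?a i) = 0" by (simp add: numeral_2_eq_2)
    ultimately show "?a sums (\<Sum>j. (1 - h (j + 2)) / lam (j + 2))"
      using sums_iff_shift[of ?a 2 "\<Sum>j. (1 - h (j + 2)) / lam (j + 2)"] by simp
    show "0 < (\<Sum>j. (1 - h (j + 2)) / lam (j + 2))"
      by (intro suminf_pos[OF summable] divide_pos_pos) (use h lam_pos in simp_all)
  qed
  interpret rank_two_data l u v "\<Sum>j. (1 - f (j + 2)) / lam (j + 2)" "\<Sum>j. (1 - g (j + 2)) / lam (j + 2)"
  proof
    show "0 \<le> l i" for i using lam_pos[of i] by (auto simp: l_def)
    show "0 \<le> u i" "u i \<le> 1" for i using f_range[of i] by (auto simp: u_def)
    show "0 \<le> v i" "v i \<le> 1" for i using g_range[of i] by (auto simp: v_def)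
    show "u i = 0 \<and> v i = 0" if "l i = 0" for i
      using that lam_pos[of i] by (auto simp: u_def v_def l_def split: if_splits)
    show "(\<lambda>i. u i / l i) sums (\<Sum>j. (1 - f (j + 2)) / lam (j + 2))" "0 < (\<Sum>j. (1 - f (j + 2)) / lam (j + 2))"
      unfolding u_def using sums[of f] f_range f_summable by blast+
    show "(\<lambda>i. v i / l i) sums (\<Sum>j. (1 - g (j + 2)) / lam (j + 2))" "0 < (\<Sum>j. (1 - g (j + 2)) / lam (j + 2))"
      unfolding v_def using sums[of g] g_range g_summable by blast+
  qed (fact f_sum g_sum)+
  \<comment> \<open>Inverse of the encoding, with the spare index 1 excluded.\<close>
  define idx :: "real \<Rightarrow> nat" where
    "idx t = (SOME m. t = (if m = 0 then 0 else 1 / real m) \<and> m \<noteq> 1)" for t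
  have idx: "t = (if idx t = 0 then 0 else 1 / real (idx t))" "idx t \<noteq> 1" if "t \<in> T" for t
  proof -
    have "\<exists>m. t = (if m = 0 then 0 else 1 / real m) \<and> m \<noteq> 1"
    proof (cases "t = 0")
      case True
      then show ?thesis by (intro exI[of _ 0]) simp
    next
      case False
      with that T obtain m where "t = 1 / real m" "m \<ge> 2" by auto
      then show ?thesis by (intro exI[of _ m]) auto
    qed
    from someI_ex[OF this]
    show "t = (if idx t = 0 then 0 else 1 / real (idx t))" "idx t \<noteq> 1"
      unfolding idx_def by blast+
  qed
  have U: "U a b = (if a = b then l (idx a) else 0) + 1 + (1 - u (idx a)) * (1 - v (idx b))"
    if ab: "a \<in> T" "b \<in> T" for a b
  proof -
    have *: "idx t = 0 \<and> t = 0 \<or> idx t \<ge> 2 \<and> t = 1 / real (idx t)" if "t \<in> T" for t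
      using idx[OF that] by (auto split: if_splits)
    show ?thesis
      using *[OF ab(1)] *[OF ab(2)]
    proof (elim disjE conjE)
      assume "idx a = 0" "a = 0" "idx b = 0" "b = 0"
      then show ?thesis by (simp add: U_00 l_def u_def v_def)
    next
      assume a: "idx a = 0" "a = 0" and b: "idx b \<ge> 2" "b = 1 / real (idx b)"
      have "U a b = 1 + g (idx b)" using U_0j[OF b(1)] a b by simp
      moreover have "a \<noteq> b" using a b by (metis divide_eq_0_iff not_numeral_le_zero of_nat_eq_0_iff zero_neq_one)
      ultimately show ?thesis using a b by (simp add: u_def v_def)
    next
      assume a: "idx a \<ge> 2" "a = 1 / real (idx a)" and b: "idx b = 0" "b = 0"
      have "U a b = 1 + f (idx a)" using U_i0[OF a(1)] a b by simp
      moreover have "a \<noteq> b" using a b by (metis divide_eq_0_iff not_numeral_le_zero of_nat_eq_0_iff zero_neq_one)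
      ultimately show ?thesis using a b by (simp add: u_def v_def)
    next
      assume a: "idx a \<ge> 2" "a = 1 / real (idx a)" and b: "idx b \<ge> 2" "b = 1 / real (idx b)"
      have "U a b = (if idx a = idx b then lam (idx a) else 0) + 1 + f (idx a) * g (idx b)"
        using U_ij[OF a(1) b(1)] a(2) b(2) by simp
      moreover have "idx a = idx b \<longleftrightarrow> a = b" using a b by metis
      ultimately show ?thesis using a b by (simp add: u_def v_def l_def)
    qed
  qed
  obtain \<mu> where \<mu>: "\<mu> \<in> space (prob_algebra seq_space)"
    and lap: "\<And>J s. finite J \<Longrightarrow> \<forall>i\<in>J. 0 \<le> s i \<Longrightarrow>
      laplace \<mu> J s = ennreal (((\<Prod>i\<in>J. 1 + l i * s i) * reduced_det J s) powr - \<alpha>)"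
    using realizable_det[OF \<alpha>] unfolding realizable_def by blast
  have [measurable_cong]: "sets \<mu> = sets seq_space" using \<mu> by (simp add: space_prob_algebra)
  interpret \<mu>: prob_space \<mu> using \<mu> by (simp add: space_prob_algebra)
  \<comment> \<open>Reading coordinate \<open>idx t\<close> at each \<open>t\<close> turns the law
    on sequences into one on functions of a real argument.\<close>
  define M :: "(real \<Rightarrow> real) measure" where
    "M = distr \<mu> (\<Pi>\<^sub>M i\<in>UNIV. borel) (\<lambda>x t. x (idx t))"
  have meas [measurable]: "(\<lambda>x t. x (idx t)) \<in> \<mu> \<rightarrow>\<^sub>M (\<Pi>\<^sub>M i\<in>(UNIV :: real set). borel :: real measure)"
    by (rule measurable_PiM_single') (auto simp: space_PiM)
  \<comment> \<open>The absolute value is the one in \<open>laplace\<close> and gives nonnegativity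
    at every sample point.\<close>
  define X where "X = (\<lambda>(t :: real) w. \<bar>w t :: real\<bar>)"
  have "permanental_process M \<alpha> T U X"
    unfolding permanental_process_def permanental_vector_def
  proof (intro allI impI conjI ballI)
    fix n and t :: "nat \<Rightarrow> real"
    assume t: "inj_on t {..<n} \<and> t ` {..<n} \<subseteq> T"
    show "prob_space M" unfolding M_def by (rule \<mu>.prob_space_distr[OF meas])
    show "\<alpha> > 0" by fact
    show "Matrix.mat n n (\<lambda>(i, j). U (t i) (t j)) \<in> carrier_mat n n" by simp
    show "X (t i) \<in> borel_measurable M" for i
      unfolding X_def M_def by simp
    show "0 \<le> X (t i) w" for i w
      by (simp add: X_def)
    fix s :: "nat \<Rightarrow> real" assume s: "\<forall>i<n. 0 \<le> s i"
    define \<tau> where "\<tau> i = idx (t i)" for i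
    have "inj_on \<tau> {..<n}"
    proof (rule inj_onI)
      fix i j assume ij: "i \<in> {..<n}" "j \<in> {..<n}" "\<tau> i = \<tau> j"
      then have "t i \<in> T" "t j \<in> T" using t by auto
      then have "t i = t j" using idx(1) ij(3) unfolding \<tau>_def by metis
      then show "i = j" using t ij by (auto dest: inj_onD)
    qed
    \<comment> \<open>\<open>s\<close> transported to the indices of the chosen points, as
      \<open>laplace\<close> expects.\<close>
    define s' where "s' k = s (inv_into {..<n} \<tau> k)" for k
    have s': "s' (\<tau> i) = s i" if "i < n" for i
      using \<open>inj_on \<tau> {..<n}\<close> that by (simp add: s'_def)
    let ?J = "\<tau> ` {..<n}"
    have "(\<integral>w. exp (- (\<Sum>i<n. s i * X (t i) w)) \<partial>M) =
        enn2real (\<integral>\<^sup>+w. ennreal (exp (- (\<Sum>i<n. s i * X (t i) w))) \<partial>M)"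
      unfolding M_def X_def by (intro integral_eq_nn_integral) auto
    also have "(\<integral>\<^sup>+w. ennreal (exp (- (\<Sum>i<n. s i * X (t i) w))) \<partial>M) = laplace \<mu> ?J s'"
      unfolding M_def X_def laplace_def
      by (subst nn_integral_distr) (auto simp: sum.reindex[OF \<open>inj_on \<tau> {..<n}\<close>] s' \<tau>_def[symmetric])
    also have "\<dots> = ennreal (((\<Prod>i\<in>?J. 1 + l i * s' i) * reduced_det ?J s') powr - \<alpha>)"
      using s s' by (intro lap) auto
    also have "(\<Prod>i\<in>?J. 1 + l i * s' i) * reduced_det ?J s' =
        Determinant.det (1\<^sub>m n + Matrix.mat n n (\<lambda>(i, j). U (t i) (t j)) * mat_diag n s)"
    proof (rule det_eq[symmetric])
      show "U (t i) (t j) = (if i = j then l (\<tau> i) else 0) + 1 + (1 - u (\<tau> i)) * (1 - v (\<tau> j))"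
        if "i < n" "j < n" for i j
      proof -
        have "t i \<in> T" "t j \<in> T" "t i = t j \<longleftrightarrow> i = j"
          using t that by (auto dest: inj_onD)
        then show ?thesis by (simp add: U \<tau>_def)
      qed
    qed (use s s' \<open>inj_on \<tau> {..<n}\<close> in auto)
    finally show "(\<integral>w. exp (- (\<Sum>i<n. s i * X (t i) w)) \<partial>M) =
        1 / Determinant.det (1\<^sub>m n + Matrix.mat n n (\<lambda>(i, j). U (t i) (t j)) * mat_diag n s) powr \<alpha>"
      by (simp add: powr_minus_divide)
  qed
  then show "\<exists>(M :: (real \<Rightarrow> real) measure) (X :: real \<Rightarrow> (real \<Rightarrow> real) \<Rightarrow> real).
    permanental_process M \<alpha> T U X"
    by blast
qed

end
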